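(* For every $\phi\in C^\infty(B_R)$, one has $$\left(\int_{B_R}|\nabla\phi|^2\,dx\right)\left(\int_{B_R}\phi^2\,dx\right)\ \ge\ \frac14\left((n-1)\int_{B_R}\frac{\phi^2}{|x|}\,dx-\int_{\partial B_R}\phi^2\,d\nu\right)^2.$$
   Context: $B_R=\{x\in\mathbb{R}^n:|x|<R\}$ is the open ball of radius $R$ centered at the origin, $\partial B_R=\{x\in\mathbb{R}^n:|x|=R\}$ is its boundary sphere, and $d\nu$ is the surface measure on $\partial B_R$.
   Formalization: The dimension is taken to be n ≥ 2: for n = 1 the claim fails (φ = 1 gives 0 on the left and, reading 0·∞ as 0, 1 on the right). Boundary values of φ are radial limits from inside, which agree with φ when it is continuous on the closed ball. *)

theory Defs
  imports "HOL-Analysis.Analysis"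
begin

definition partial_deriv :: "'n \<Rightarrow> (real ^ 'n::finite \<Rightarrow> real) \<Rightarrow> real ^ 'n \<Rightarrow> real" where
  "partial_deriv i f x = frechet_derivative f (at x) (axis i 1)"

definition gradient :: "(real ^ 'n::finite \<Rightarrow> real) \<Rightarrow> real ^ 'n \<Rightarrow> real ^ 'n" where
  "gradient f x = (\<chi> i. partial_deriv i f x)"

text \<open>Only meant for open \<open>S\<close>: the derivatives are unrestricted ones, at points of \<open>S\<close>,
  so the values of \<open>f\<close> outside \<open>S\<close> are irrelevant.\<close>

primrec Ck_on :: "nat \<Rightarrow> (real ^ 'n::finite) set \<Rightarrow> (real ^ 'n \<Rightarrow> real) \<Rightarrow> bool" where
  "Ck_on 0 S f \<longleftrightarrow> continuous_on S f"
| "Ck_on (Suc k) S f \<longleftrightarrow>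
     (\<forall>x\<in>S. f differentiable (at x)) \<and> (\<forall>i. Ck_on k S (partial_deriv i f))"

definition Cinf_on :: "(real ^ 'n::finite) set \<Rightarrow> (real ^ 'n \<Rightarrow> real) \<Rightarrow> bool" where
  "Cinf_on S f \<longleftrightarrow> (\<forall>k. Ck_on k S f)"

text \<open>Surface measure of the sphere of radius \<open>R\<close>, as a Borel measure on the whole space
  (the origin, where the radial projection is \<open>0\<close>, is a null set). It is defined by
  the usual cone construction: a Borel set \<open>A\<close> of the sphere has area \<open>n / R\<close> times the
  volume of the cone over \<open>A\<close> with apex \<open>0\<close>; see \<open>emeasure_sphere_measure\<close> below.\<close>

definition sphere_measure :: "real \<Rightarrow> (real ^ 'n::finite) measure" where
  "sphere_measure R =
     scale_measure (ennreal (real CARD('n) / R))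
       (distr (restrict_space lborel (ball 0 R)) borel (\<lambda>x. (R / norm x) *\<^sub>R x))"

text \<open>A function in \<open>C\<^sup>\<infinity>(B\<^sub>R)\<close> need not be defined or continuous on the boundary;
  its boundary value at a point of the sphere is its radial limit from inside. If \<open>\<phi>\<close> is
  continuous on the closed ball, this is just \<open>\<phi>\<close>. The radial limit exists
  at almost every point of the sphere whenever the gradient is square integrable on the ball.\<close>

definition boundary_value :: "(real ^ 'n::finite \<Rightarrow> real) \<Rightarrow> real ^ 'n \<Rightarrow> real" where
  "boundary_value \<phi> x = Lim (at_left 1) (\<lambda>t::real. \<phi> (t *\<^sub>R x))"

lemma sets_sphere_measure [simp, measurable_cong]: "sets (sphere_measure R) = sets borel"
  by (simp add: sphere_measure_def)

lemma space_sphere_measure [simp]: "space (sphere_measure R) = UNIV"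
  by (simp add: sphere_measure_def space_scale_measure)

lemma emeasure_sphere_measure:
  fixes A :: "(real ^ 'n::finite) set"
  assumes R: "0 < R" and A: "A \<in> sets borel" "A \<subseteq> sphere 0 R"
  shows "emeasure (sphere_measure R) A =
    ennreal (real CARD('n) / R) * emeasure lborel {t *\<^sub>R x | t x. 0 < t \<and> t < 1 \<and> x \<in> A}"
proof -
  have m: "(\<lambda>x::real^'n. (R / norm x) *\<^sub>R x) \<in> borel_measurable (restrict_space lborel (ball 0 R))"
    by (intro measurable_restrict_space1) simp
  have "(\<lambda>x. (R / norm x) *\<^sub>R x) -` A \<inter> ball 0 R = {t *\<^sub>R x | t x. 0 < t \<and> t < 1 \<and> x \<in> A}"
    (is "?L = ?C")
  proof (intro equalityI subsetI)
    fix y assume y: "y \<in> ?L"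
    with A(2) R have "y \<noteq> 0" by auto
    with y R have "y = (norm y / R) *\<^sub>R ((R / norm y) *\<^sub>R y)" "0 < norm y / R" "norm y / R < 1"
      by auto
    with y show "y \<in> ?C" by blast
  next
    fix y assume "y \<in> ?C"
    then obtain t x where tx: "y = t *\<^sub>R x" "0 < t" "t < 1" "x \<in> A" by blast
    with A(2) have "norm x = R" by auto
    with tx R show "y \<in> ?L" by simp
  qed
  moreover have "?C \<subseteq> ball 0 R"
    using calculation by blast
  ultimately show ?thesis
    using A(1) m by (simp add: sphere_measure_def emeasure_distr space_restrict_space
        emeasure_restrict_space)
qed

lemma emeasure_sphere_measure_sphere:
  assumes R: "0 < R"
  shows "emeasure (sphere_measure R) (sphere (0::real ^ 'n::finite) R) =
    ennreal (real CARD('n) * unit_ball_vol (real CARD('n)) * R ^ (CARD('n) - 1))"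
proof -
  have C: "{t *\<^sub>R x | t x. 0 < t \<and> t < 1 \<and> x \<in> sphere (0::real^'n) R} = ball 0 R - {0}" (is "?C = _")
  proof (intro equalityI subsetI)
    fix y :: "real^'n" assume "y \<in> ?C" with R show "y \<in> ball 0 R - {0}" by auto
  next
    fix y :: "real^'n" assume "y \<in> ball 0 R - {0}"
    with R have "y = (norm y / R) *\<^sub>R ((R / norm y) *\<^sub>R y)" "0 < norm y / R" "norm y / R < 1"
      "(R / norm y) *\<^sub>R y \<in> sphere 0 R" by auto
    then show "y \<in> ?C" by blast
  qed
  have "emeasure lborel (ball (0::real^'n) R - {0}) = emeasure lborel (ball (0::real^'n) R)"
    by (intro emeasure_Diff_null_set) auto
  also have "\<dots> = ennreal (unit_ball_vol (real CARD('n)) * R ^ CARD('n))"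
    using R by (simp add: emeasure_ball)
  finally have E: "emeasure (sphere_measure R) (sphere (0::real ^ 'n::finite) R) =
      ennreal (real CARD('n) / R * (unit_ball_vol (real CARD('n)) * R ^ CARD('n)))"
    using R C by (subst emeasure_sphere_measure) (simp_all add: ennreal_mult[symmetric] del: mem_sphere_0)
  have "R ^ CARD('n) = R * R ^ (CARD('n) - 1)"
    by (simp flip: power_Suc)
  with E R show ?thesis by (simp add: mult_ac)
qed

lemma boundary_value_continuous:
  fixes \<phi> :: "real ^ 'n::finite \<Rightarrow> real"
  assumes "0 < R" "continuous_on (cball 0 R) \<phi>" "x \<in> sphere 0 R"
  shows "boundary_value \<phi> x = \<phi> x"
proof -
  have "continuous_on {0..1::real} (\<lambda>t. \<phi> (t *\<^sub>R x))"
    using assms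
    by (intro continuous_on_compose2[OF assms(2)] continuous_intros)
       (auto simp: mult_left_le_one_le)
  then have "((\<lambda>t. \<phi> (t *\<^sub>R x)) \<longlongrightarrow> \<phi> (1 *\<^sub>R x)) (at 1 within {0..1::real})"
    unfolding continuous_on by (rule bspec) simp
  then have "((\<lambda>t. \<phi> (t *\<^sub>R x)) \<longlongrightarrow> \<phi> x) (at_left (1::real))"
    by (simp add: at_within_Icc_at_left)
  then show ?thesis
    unfolding boundary_value_def by (intro tendsto_Lim) auto
qed

end

theory Submission
  imports Defs
begin

text \<open>Let \<open>n\<close> be the dimension. If both integrals on the left are finite, then on almost every ray
  \<open>s \<mapsto> s x\<close> with \<open>|x| = R\<close> the function \<open>\<phi>\<close> has a limit at the boundary, and integrating the derivative
  of \<open>s\<^bsup>n-1\<^esup> \<phi>(s x)\<^sup>2\<close> over the ray and then over all directions gives the divergence identity for the field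
  \<open>\<phi>\<^sup>2 x / |x|\<close>:
  \<open>\<integral>\<^bsub>\<partial>B\<^esub> \<phi>\<^sup>2 = (n - 1) \<integral>\<^bsub>B\<^esub> \<phi>\<^sup>2 / |x| + 2 \<integral>\<^bsub>B\<^esub> \<phi> (\<nabla>\<phi> \<bullet> x) / |x|\<close>.
  The Cauchy--Schwarz inequality bounds the last integral. If one integral on the left is infinite,
  the other one does not vanish, so the left-hand side is infinite.\<close>

section \<open>Polar coordinates on the ball\<close>

text \<open>The distribution of \<open>|x| / R\<close> under Lebesgue measure on the ball, normalised so that its product
  with \<^const>\<open>sphere_measure\<close> \<open>R\<close> is the polar decomposition of the ball; the density factor \<open>R\<close>
  appears because the radius is \<open>s R\<close> with \<open>0 < s < 1\<close>.\<close>

definition radial_measure :: "nat \<Rightarrow> real \<Rightarrow> real measure" where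
  "radial_measure n R = density lborel (\<lambda>s. ennreal (indicator {0<..<1} s * (R * s ^ (n - 1))))"

lemma sets_radial_measure [simp, measurable_cong]: "sets (radial_measure n R) = sets borel"
  by (simp add: radial_measure_def)

lemma space_radial_measure [simp]: "space (radial_measure n R) = UNIV"
  by (simp add: radial_measure_def)

lemma emeasure_radial_measure_lessThan:
  assumes "0 < n" "0 < R"
  shows "emeasure (radial_measure n R) {..<a} = ennreal (R / real n * (max 0 (min 1 a)) ^ n)"
proof -
  define m where "m = max 0 (min 1 a)"
  have m: "0 \<le> m" "m \<le> 1" by (auto simp: m_def)
  have "emeasure (radial_measure n R) {..<a} =
      (\<integral>\<^sup>+s. ennreal (indicator {0<..<1} s * (R * s ^ (n - 1))) * indicator {..<a} s \<partial>lborel)"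
    unfolding radial_measure_def by (rule emeasure_density) auto
  also have "\<dots> = (\<integral>\<^sup>+s. ennreal (R * s ^ (n - 1)) * indicator {0..m} s \<partial>lborel)"
  proof (rule nn_integral_cong_AE)
    have "AE s in lborel. s \<notin> {0, 1, a::real}"
      by (intro AE_not_in) (auto intro: finite_imp_null_set_lborel)
    then show "AE s in lborel. ennreal (indicator {0<..<1} s * (R * s ^ (n - 1))) * indicator {..<a} s
        = ennreal (R * s ^ (n - 1)) * indicator {0..m} s"
      by eventually_elim (auto simp: m_def indicator_def)
  qed
  also have "\<dots> = ennreal (R / real n * m ^ n - R / real n * 0 ^ n)"
  proof (rule nn_integral_FTC_Icc)
    fix s assume "s \<in> {0..m}"
    show "((\<lambda>s. R / real n * s ^ n) has_real_derivative R * s ^ (n - 1)) (at s)"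
      using assms by (auto intro!: derivative_eq_intros)
    show "0 \<le> R * s ^ (n - 1)" using assms \<open>s \<in> {0..m}\<close> by simp
  qed (use m in auto)
  finally show ?thesis using assms by (simp add: m_def power_0_left)
qed

lemma finite_measure_radial_measure:
  assumes "0 < n" "0 < R"
  shows "finite_measure (radial_measure n R)"
proof
  have "emeasure (radial_measure n R) UNIV = emeasure (radial_measure n R) {..<1}"
  proof (rule emeasure_eq_AE)
    show "AE s in radial_measure n R. s \<in> UNIV \<longleftrightarrow> s \<in> {..<1}"
      unfolding radial_measure_def by (subst AE_density) (auto simp: indicator_def)
  qed auto
  then show "emeasure (radial_measure n R) (space (radial_measure n R)) \<noteq> \<infinity>"
    using assms by (simp add: emeasure_radial_measure_lessThan)
qed

lemma emeasure_sphere_measure_cone: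
  fixes B :: "(real ^ 'n::finite) set"
  assumes "0 < R" "B \<in> sets borel"
  shows "emeasure (sphere_measure R) B =
    ennreal (real CARD('n) / R) * emeasure lborel {x \<in> ball 0 R. (R / norm x) *\<^sub>R x \<in> B}"
proof -
  have m: "(\<lambda>x::real^'n. (R / norm x) *\<^sub>R x) \<in> borel_measurable (restrict_space lborel (ball 0 R))"
    by (intro measurable_restrict_space1) simp
  have "(\<lambda>x. (R / norm x) *\<^sub>R x) -` B \<inter> ball 0 R = {x \<in> ball 0 R. (R / norm x) *\<^sub>R x \<in> B}"
    by auto
  then show ?thesis
    using assms m by (simp add: sphere_measure_def emeasure_distr space_restrict_space
        emeasure_restrict_space subset_eq)
qed

lemma finite_measure_sphere_measure:
  assumes "0 < R"
  shows "finite_measure (sphere_measure R :: (real ^ 'n::finite) measure)"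
proof
  have "emeasure (sphere_measure R) (UNIV :: (real^'n) set) =
      ennreal (real CARD('n) / R) * emeasure lborel (ball (0::real^'n) R)"
    using assms by (subst emeasure_sphere_measure_cone) (auto simp: ball_def)
  then show "emeasure (sphere_measure R :: (real^'n) measure) (space (sphere_measure R)) \<noteq> \<infinity>"
    using emeasure_lborel_ball_finite[of "0::real^'n" R]
    by (auto simp: ennreal_mult_eq_top_iff)
qed

lemma AE_sphere_measure_sphere:
  assumes "0 < R"
  shows "AE x in sphere_measure R. x \<in> sphere (0 :: real ^ 'n::finite) R"
proof (rule AE_I)
  have "{x \<in> ball (0::real^'n) R. (R / norm x) *\<^sub>R x \<in> - sphere 0 R} \<subseteq> {0}"
    using assms by auto
  then have "{x \<in> ball (0::real^'n) R. (R / norm x) *\<^sub>R x \<in> - sphere 0 R} \<in> null_sets lborel"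
    by (rule finite_imp_null_set_lborel[OF finite_subset]) simp
  then show "emeasure (sphere_measure R) (- sphere (0 :: real ^ 'n) R) = 0"
    using assms by (subst emeasure_sphere_measure_cone) auto
qed auto

lemma emeasure_lborel_scaleR_vimage:
  fixes D :: "'a::euclidean_space set"
  assumes "0 < c" and [measurable]: "D \<in> sets borel"
  shows "emeasure lborel D = ennreal (c ^ DIM('a)) * emeasure lborel {x. c *\<^sub>R x \<in> D}"
proof -
  have "emeasure lborel D =
      emeasure (density (distr lborel borel (\<lambda>x::'a. 0 + c *\<^sub>R x)) (\<lambda>_. \<bar>c\<bar> ^ DIM('a))) D"
    using assms by (subst lborel_affine[of c 0]) auto
  also have "\<dots> = ennreal (c ^ DIM('a)) * emeasure (distr lborel borel (\<lambda>x::'a. c *\<^sub>R x)) D"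
    using assms by (simp add: emeasure_density_const)
  also have "emeasure (distr lborel borel (\<lambda>x::'a. c *\<^sub>R x)) D = emeasure lborel {x. c *\<^sub>R x \<in> D}"
    by (subst emeasure_distr) (auto simp: vimage_def)
  finally show ?thesis .
qed

lemma emeasure_cone_sector:
  fixes B :: "(real ^ 'n::finite) set"
  assumes R: "0 < R" and B: "B \<in> sets borel"
  defines "C \<equiv> {x \<in> ball 0 R. (R / norm x) *\<^sub>R x \<in> B}"
  shows "emeasure lborel {x \<in> C. norm x / R < a} =
    ennreal ((max 0 (min 1 a)) ^ CARD('n)) * emeasure lborel C"
proof -
  have [measurable]: "C \<in> sets borel"
    using B unfolding C_def by measurable
  consider "a \<le> 0" | "0 < a" "a < 1" | "1 \<le> a" by linarith
  then show ?thesis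
  proof cases
    case 1
    then have "{x \<in> C. norm x / R < a} = {}"
      using R by (auto simp: not_less intro: order.trans[OF 1])
    with 1 show ?thesis by (simp only:) (simp add: power_0_left)
  next
    case 2
    have eq: "{x. a *\<^sub>R x \<in> {x \<in> C. norm x / R < a}} = C"
    proof -
      have "R * a \<le> R * 1" using 2 R by (intro mult_left_mono) auto
      moreover have "norm x * a < R * a" if "norm x < R" for x :: "real^'n"
        using 2 that by (intro mult_strict_right_mono)
      ultimately have "norm x < R \<Longrightarrow> norm x * a < R" for x :: "real^'n"
        by fastforce
      then have n1: "norm x < R \<Longrightarrow> norm (a *\<^sub>R x) < R" for x :: "real^'n"
        using 2 by (simp add: mult.commute)
      have n2: "norm (a *\<^sub>R x) / R < a \<longleftrightarrow> norm x < R" for x :: "real^'n"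
        using 2 R by (simp add: field_simps)
      have n3: "(R / norm (a *\<^sub>R x)) *\<^sub>R (a *\<^sub>R x) = (R / norm x) *\<^sub>R x" for x :: "real^'n"
        using 2 by simp
      have "a *\<^sub>R x \<in> {x \<in> C. norm x / R < a} \<longleftrightarrow> x \<in> C" for x
        unfolding C_def mem_Collect_eq mem_ball_0 n2 n3 using n1[of x] by argo
      then show ?thesis by simp
    qed
    have "emeasure lborel {x \<in> C. norm x / R < a} =
        ennreal (a ^ DIM(real^'n)) * emeasure lborel {x. a *\<^sub>R x \<in> {x \<in> C. norm x / R < a}}"
      using 2 by (intro emeasure_lborel_scaleR_vimage) measurable
    with eq 2 show ?thesis by simp
  next
    case 3
    then have "{x \<in> C. norm x / R < a} = C"
      using R by (auto simp: C_def field_simps intro: less_le_trans[of _ R])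
    with 3 show ?thesis by simp
  qed
qed

lemma emeasure_sector:
  fixes B :: "(real ^ 'n::finite) set"
  assumes R: "0 < R" and A[measurable]: "A \<in> sets borel" and B[measurable]: "B \<in> sets borel"
  shows "emeasure (radial_measure CARD('n) R) A * emeasure (sphere_measure R) B =
    emeasure lborel {x \<in> ball 0 R. norm x / R \<in> A \<and> (R / norm x) *\<^sub>R x \<in> B}"
proof -
  let ?n = "CARD('n)"
  define C where "C = {x \<in> ball 0 R. (R / norm x) *\<^sub>R x \<in> B}"
  have C[measurable]: "C \<in> sets borel" unfolding C_def by measurable
  let ?\<mu> = "distr (density lborel (indicator C)) borel (\<lambda>x. norm x / R)"
  let ?\<nu> = "scale_measure (emeasure (sphere_measure R) B) (radial_measure ?n R)"
  interpret r: finite_measure "radial_measure ?n R"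
    using R by (intro finite_measure_radial_measure) auto
  interpret s: finite_measure "sphere_measure R :: (real^'n) measure"
    using R by (rule finite_measure_sphere_measure)
  have mu: "emeasure ?\<mu> X = emeasure lborel {x \<in> C. norm x / R \<in> X}" if [measurable]: "X \<in> sets borel" for X
  proof -
    have [measurable]: "(\<lambda>x::real^'n. norm x / R) -` X \<in> sets borel"
      using that by (rule measurable_sets_borel[rotated]) measurable
    have "emeasure ?\<mu> X = (\<integral>\<^sup>+x. indicator C x * indicator ((\<lambda>x. norm x / R) -` X) x \<partial>lborel)"
      by (simp add: emeasure_distr emeasure_density)
    also have "\<dots> = (\<integral>\<^sup>+x. indicator {x \<in> C. norm x / R \<in> X} x \<partial>lborel)"
      by (intro nn_integral_cong) (auto simp: indicator_def)
    finally show ?thesis by simp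
  qed
  have "?\<nu> = ?\<mu>"
  proof (rule measure_eqI_generator_eq[where E = "range lessThan" and \<Omega> = UNIV and A = "\<lambda>i::nat. {..<real i}"])
    show "Int_stable (range lessThan :: real set set)"
    proof (rule Int_stableI_image)
      show "\<exists>c\<in>UNIV. {..<a} \<inter> {..<b} = {..<c}" for a b :: real
        by (rule bexI[of _ "min a b"]) auto
    qed
    fix X :: "real set" assume "X \<in> range lessThan"
    then obtain a where X: "X = {..<a}" by auto
    let ?m = "max 0 (min 1 a)"
    have "emeasure ?\<nu> X = (ennreal (real ?n / R) * emeasure lborel C) * ennreal (R / real ?n * ?m ^ ?n)"
      using R by (simp add: X emeasure_radial_measure_lessThan emeasure_sphere_measure_cone C_def)
    also have "\<dots> = ennreal (real ?n / R * (R / real ?n * ?m ^ ?n)) * emeasure lborel C"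
      using R by (subst ennreal_mult) (auto simp: mult_ac)
    also have "\<dots> = ennreal (?m ^ ?n) * emeasure lborel C"
      using R by simp
    also have "\<dots> = emeasure ?\<mu> X"
      using R emeasure_cone_sector[OF R B, of a, folded C_def] by (simp add: mu X)
    finally show "emeasure ?\<nu> X = emeasure ?\<mu> X" .
  next
    show "sets ?\<nu> = sigma_sets UNIV (range lessThan)"
      by (simp add: borel_Iio)
    show "sets ?\<mu> = sigma_sets UNIV (range lessThan)"
      by (simp add: borel_Iio)
    show "(\<Union>i. {..<real i}) = UNIV"
      by (auto intro: reals_Archimedean2)
    show "emeasure ?\<nu> {..<real i} \<noteq> \<infinity>" for i
      by (simp add: ennreal_mult_eq_top_iff)
  qed auto
  then have "emeasure ?\<nu> A = emeasure ?\<mu> A" by simp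
  also have "emeasure ?\<mu> A = emeasure lborel {x \<in> ball 0 R. norm x / R \<in> A \<and> (R / norm x) *\<^sub>R x \<in> B}"
    unfolding mu[OF A] by (simp add: C_def conj_ac)
  finally show ?thesis by (simp add: mult.commute)
qed

lemma polar_coordinates:
  assumes R: "0 < R"
  shows "distr (radial_measure CARD('n) R \<Otimes>\<^sub>M sphere_measure R) borel (\<lambda>(s, x). s *\<^sub>R x) =
    density lborel (\<lambda>x::real^'n::finite. ennreal (indicator (ball 0 R) x))"
proof -
  let ?P = "density lborel (\<lambda>x::real^'n. ennreal (indicator (ball 0 R) x))"
  let ?T = "\<lambda>x::real^'n. (norm x / R, (R / norm x) *\<^sub>R x)"
  interpret r: finite_measure "radial_measure CARD('n) R"
    using R by (intro finite_measure_radial_measure) auto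
  interpret s: finite_measure "sphere_measure R :: (real^'n) measure"
    using R by (rule finite_measure_sphere_measure)
  have "radial_measure CARD('n) R \<Otimes>\<^sub>M sphere_measure R = distr ?P (borel \<Otimes>\<^sub>M borel) ?T"
  proof (rule pair_measure_eqI)
    fix A :: "real set" and B :: "(real^'n) set"
    assume "A \<in> sets (radial_measure CARD('n) R)" "B \<in> sets (sphere_measure R)"
    then have [measurable]: "A \<in> sets borel" "B \<in> sets borel" by auto
    have [measurable]: "?T -` (A \<times> B) \<in> sets borel"
      by (rule measurable_sets_borel[where M = "borel \<Otimes>\<^sub>M borel"]) measurable
    have "emeasure (distr ?P (borel \<Otimes>\<^sub>M borel) ?T) (A \<times> B) = emeasure ?P (?T -` (A \<times> B))"
      by (subst emeasure_distr) auto
    also have "\<dots> = (\<integral>\<^sup>+x. ennreal (indicator (ball 0 R) x) * indicator (?T -` (A \<times> B)) x \<partial>lborel)"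
      by (rule emeasure_density) (simp_all add: borel_measurable_indicator \<open>?T -` (A \<times> B) \<in> sets borel\<close>)
    also have "\<dots> = (\<integral>\<^sup>+x. indicator {x \<in> ball 0 R. norm x / R \<in> A \<and> (R / norm x) *\<^sub>R x \<in> B} x \<partial>lborel)"
      by (intro nn_integral_cong) (auto simp: indicator_def)
    also have "\<dots> = emeasure lborel {x \<in> ball 0 R. norm x / R \<in> A \<and> (R / norm x) *\<^sub>R x \<in> B}"
      by (subst nn_integral_indicator) auto
    finally show "emeasure (radial_measure CARD('n) R) A * emeasure (sphere_measure R) B =
        emeasure (distr ?P (borel \<Otimes>\<^sub>M borel) ?T) (A \<times> B)"
      using R by (simp add: emeasure_sector)
  next
    show "sets (radial_measure CARD('n) R \<Otimes>\<^sub>M sphere_measure R) = sets (distr ?P (borel \<Otimes>\<^sub>M borel) ?T)"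
      by (simp cong: sets_pair_measure_cong)
  qed (rule r.sigma_finite_measure_axioms s.sigma_finite_measure_axioms)+
  then have "distr (radial_measure CARD('n) R \<Otimes>\<^sub>M sphere_measure R) borel (\<lambda>(s, x). s *\<^sub>R x) =
      distr ?P borel ((\<lambda>(s, x). s *\<^sub>R x) \<circ> ?T)"
    by (simp add: distr_distr)
  also have "(\<lambda>(s, x). s *\<^sub>R x) \<circ> ?T = (\<lambda>x. x)"
    using R by (auto simp: fun_eq_iff)
  also have "distr ?P borel (\<lambda>x. x) = ?P"
    by (rule distr_id2) simp
  finally show ?thesis .
qed

lemma integral_polar_coordinates:
  fixes h :: "real ^ 'n::finite \<Rightarrow> real"
  assumes R: "0 < R" and h[measurable]: "h \<in> borel_measurable borel"
    and int: "set_integrable lborel (ball 0 R) h"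
  defines "I \<equiv> \<lambda>x. LINT s:{0<..<1}|lborel. R * s ^ (CARD('n) - 1) * h (s *\<^sub>R x)"
  shows "AE x in sphere_measure R.
      set_integrable lborel {0<..<1} (\<lambda>s. R * s ^ (CARD('n) - 1) * h (s *\<^sub>R x))"
    and "I \<in> borel_measurable (sphere_measure R)"
    and "(LINT x|sphere_measure R. I x) = (LINT x:ball 0 R|lborel. h x)"
proof -
  let ?M = "radial_measure CARD('n) R" and ?S = "sphere_measure R :: (real^'n) measure"
  let ?P = "density lborel (\<lambda>x::real^'n. ennreal (indicator (ball 0 R) x))"
  interpret r: finite_measure ?M
    using R by (intro finite_measure_radial_measure) auto
  interpret s: finite_measure ?S
    using R by (rule finite_measure_sphere_measure)
  interpret pair_sigma_finite ?M ?S ..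
  have ball: "indicator (ball (0::real^'n) R) \<in> borel_measurable lborel" for R :: real
    by (intro borel_measurable_indicator) simp
  have P: "integrable ?P h" "integral\<^sup>L ?P h = (LINT x:ball 0 R|lborel. h x)"
    using int unfolding set_integrable_def set_lebesgue_integral_def
    by (subst integrable_density integral_density; simp add: ball[unfolded measurable_lborel2])+
  have int2: "integrable (?M \<Otimes>\<^sub>M ?S) (\<lambda>(s, x). h (s *\<^sub>R x))"
    using P(1) unfolding polar_coordinates[OF R, symmetric]
    by (subst (asm) integrable_distr_eq) (simp_all add: case_prod_unfold)
  have eq: "integral\<^sup>L (?M \<Otimes>\<^sub>M ?S) (\<lambda>(s, x). h (s *\<^sub>R x)) = integral\<^sup>L ?P h"
    unfolding polar_coordinates[OF R, symmetric]
    by (subst integral_distr) (simp_all add: case_prod_unfold)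
  have w: "AE s in lborel. 0 \<le> indicator {0<..<1} s * (R * s ^ (CARD('n) - 1))"
    using R by (intro AE_I2) (auto simp: indicator_def)
  have I: "I x = (LINT s|?M. h (s *\<^sub>R x))" for x
    unfolding I_def radial_measure_def set_lebesgue_integral_def
    by (subst integral_density) (use w in \<open>simp_all add: mult_ac\<close>)
  have "integrable ?M (\<lambda>s. h (s *\<^sub>R x)) \<longleftrightarrow>
      set_integrable lborel {0<..<1} (\<lambda>s. R * s ^ (CARD('n) - 1) * h (s *\<^sub>R x))" for x
    unfolding radial_measure_def set_integrable_def
    by (subst integrable_density) (use w in \<open>simp_all add: mult_ac\<close>)
  then show "AE x in ?S. set_integrable lborel {0<..<1} (\<lambda>s. R * s ^ (CARD('n) - 1) * h (s *\<^sub>R x))"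
    using AE_integrable_snd[OF int2] by simp
  show "I \<in> borel_measurable ?S"
    using borel_measurable_integrable[OF integrable_snd[OF int2]] by (simp add: I[abs_def])
  show "(LINT x|?S. I x) = (LINT x:ball 0 R|lborel. h x)"
    using integral_snd[OF int2] eq P(2) by (simp add: I)
qed

lemma set_integrable_ball_inverse_norm:
  assumes n: "2 \<le> CARD('n::finite)" and R: "0 < R"
  shows "set_integrable lborel (ball 0 R) (\<lambda>x::real^'n. 1 / norm x)"
proof -
  let ?M = "radial_measure CARD('n) R" and ?S = "sphere_measure R :: (real^'n) measure"
  let ?P = "density lborel (\<lambda>x::real^'n. ennreal (indicator (ball 0 R) x))"
  interpret r: finite_measure ?M
    using R by (intro finite_measure_radial_measure) auto
  interpret s: finite_measure ?S
    using R by (rule finite_measure_sphere_measure)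
  interpret pair_sigma_finite ?M ?S ..
  have "(\<integral>\<^sup>+x. ennreal (1 / norm x) \<partial>?P) = (\<integral>\<^sup>+(s, x). ennreal (1 / norm (s *\<^sub>R x)) \<partial>(?M \<Otimes>\<^sub>M ?S))"
    unfolding polar_coordinates[OF R, symmetric]
    by (subst nn_integral_distr) (simp_all add: case_prod_unfold)
  also have "\<dots> = (\<integral>\<^sup>+x. (\<integral>\<^sup>+s. ennreal (1 / norm (s *\<^sub>R x)) \<partial>?M) \<partial>?S)"
    by (subst nn_integral_snd[symmetric]) (simp_all add: case_prod_unfold)
  also have "\<dots> \<le> (\<integral>\<^sup>+x. 1 \<partial>?S)"
  proof (rule nn_integral_mono_AE)
    show "AE x in ?S. (\<integral>\<^sup>+s. ennreal (1 / norm (s *\<^sub>R x)) \<partial>?M) \<le> 1"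
      using AE_sphere_measure_sphere[OF R]
    proof eventually_elim
      case (elim x)
      have "(\<integral>\<^sup>+s. ennreal (1 / norm (s *\<^sub>R x)) \<partial>?M) =
          (\<integral>\<^sup>+s. ennreal (indicator {0<..<1} s * (R * s ^ (CARD('n) - 1))) * ennreal (1 / norm (s *\<^sub>R x)) \<partial>lborel)"
        unfolding radial_measure_def by (rule nn_integral_density) measurable
      also have "\<dots> \<le> (\<integral>\<^sup>+s. indicator {0..1::real} s \<partial>lborel)"
      proof (rule nn_integral_mono)
        fix s :: real
        show "ennreal (indicator {0<..<1} s * (R * s ^ (CARD('n) - 1))) * ennreal (1 / norm (s *\<^sub>R x))
            \<le> indicator {0..1} s"
        proof (cases "s \<in> {0<..<1}")
          case True
          have "R * s ^ (CARD('n) - 1) * (1 / norm (s *\<^sub>R x)) = s ^ (CARD('n) - 2)"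
          proof -
            have "CARD('n) - 1 = Suc (CARD('n) - 2)" using n by simp
            then show ?thesis using True elim R by simp
          qed
          also have "\<dots> \<le> 1" using True by (intro power_le_one) auto
          finally show ?thesis
            using True R by (simp flip: ennreal_mult)
        qed simp
      qed
      also have "\<dots> = 1" by simp
      finally show ?case .
    qed
  qed
  also have "\<dots> < \<infinity>" using s.emeasure_finite[of UNIV] by (simp add: less_top[symmetric])
  finally have "integrable ?P (\<lambda>x. 1 / norm x)"
    by (intro integrableI_bounded) auto
  then show ?thesis
    unfolding set_integrable_def by (subst (asm) integrable_density) (auto intro!: borel_measurable_indicator)
qed

section \<open>Radial limits at the boundary\<close>

lemma tendsto_at_left_FTC:
  fixes P q :: "real \<Rightarrow> real"
  assumes cb: "c < b"
    and deriv: "\<And>s. c \<le> s \<Longrightarrow> s < b \<Longrightarrow> (P has_real_derivative q s) (at s)"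
    and int: "set_integrable lborel {c<..<b} q"
  shows "(P \<longlongrightarrow> P c + (LINT s:{c<..<b}|lborel. q s)) (at_left b)"
proof -
  have I: "q integrable_on {c<..<b}" "(LINT s:{c<..<b}|lborel. q s) = integral {c<..<b} q"
    using set_borel_integral_eq_integral[OF int] by auto
  have q: "q integrable_on {c..b}"
    using I(1) by (simp add: integrable_on_Icc_iff_Ioo)
  have "continuous_on {c..b} (\<lambda>x. P c + integral {c..x} q)"
    by (intro continuous_intros indefinite_integral_continuous_1 q)
  then have "((\<lambda>x. P c + integral {c..x} q) \<longlongrightarrow> P c + integral {c..b} q) (at b within {c..b})"
    using cb by (auto simp: continuous_on_def)
  then have lim: "((\<lambda>x. P c + integral {c..x} q) \<longlongrightarrow> P c + integral {c..b} q) (at_left b)"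
    using cb by (simp add: at_within_Icc_at_left)
  have "eventually (\<lambda>x. x \<in> {c<..<b}) (at_left b)"
    by (rule eventually_at_left_real[OF cb])
  then have "eventually (\<lambda>x. P c + integral {c..x} q = P x) (at_left b)"
  proof eventually_elim
    case (elim x)
    have "(q has_integral (P x - P c)) {c..x}"
    proof (rule fundamental_theorem_of_calculus)
      show "(P has_vector_derivative q s) (at s within {c..x})" if "s \<in> {c..x}" for s
        unfolding has_real_derivative_iff_has_vector_derivative[symmetric]
        using elim that by (intro has_field_derivative_at_within[OF deriv]) auto
    qed (use elim in auto)
    then show ?case by (simp add: integral_unique)
  qed
  with lim have "(P \<longlongrightarrow> P c + integral {c..b} q) (at_left b)"
    by (rule Lim_transform_eventually)
  then show ?thesis by (simp add: I(2) integral_open_interval_real)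
qed

text \<open>With \<open>p s = \<phi> (s x)\<close> this gives the boundary value of \<open>\<phi>\<close> in the direction \<open>x\<close>: \<open>p'\<close> is integrable
  near \<open>1\<close>, so \<open>p\<close> has a limit there, whose square is found by integrating \<open>(s\<^sup>m p\<^sup>2)'\<close>.\<close>

lemma radial_trace:
  fixes p p' :: "real \<Rightarrow> real"
  assumes m: "0 < m"
    and deriv: "\<And>s. 0 \<le> s \<Longrightarrow> s < 1 \<Longrightarrow> (p has_real_derivative p' s) (at s)"
    and cont: "continuous_on {0..<1} p'"
    and int1: "set_integrable lborel {0<..<1} (\<lambda>s. s ^ m * (p' s)\<^sup>2)"
    and int2: "set_integrable lborel {0<..<1}
      (\<lambda>s. real m * s ^ (m - 1) * (p s)\<^sup>2 + 2 * s ^ m * p s * p' s)"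
  obtains l where "(p \<longlongrightarrow> l) (at_left 1)"
    "l\<^sup>2 = (LINT s:{0<..<1}|lborel. real m * s ^ (m - 1) * (p s)\<^sup>2 + 2 * s ^ m * p s * p' s)"
proof -
  let ?q = "\<lambda>s. real m * s ^ (m - 1) * (p s)\<^sup>2 + 2 * s ^ m * p s * p' s"
  have d2: "((\<lambda>s. s ^ m * (p s)\<^sup>2) has_real_derivative ?q s) (at s)" if "0 \<le> s" "s < 1" for s
    by (rule derivative_eq_intros deriv that refl)+ (simp add: algebra_simps power2_eq_square)
  have lim2: "((\<lambda>s. s ^ m * (p s)\<^sup>2) \<longlongrightarrow> 0 ^ m * (p 0)\<^sup>2 + (LINT s:{0<..<1}|lborel. ?q s)) (at_left 1)"
    by (rule tendsto_at_left_FTC[OF _ d2 int2]) auto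
  have "set_integrable lborel {1/2<..<1} p'"
  proof (rule set_integrable_bound)
    have "set_integrable lborel {1/2<..<1::real} (\<lambda>s. s ^ m * (p' s)\<^sup>2)"
      by (rule set_integrable_subset[OF int1]) auto
    moreover have "set_integrable lborel {1/2<..<1::real} (\<lambda>s. 1::real)"
      by (simp add: set_integrable_def integrable_indicator_iff less_top[symmetric])
    ultimately show "set_integrable lborel {1/2<..<1} (\<lambda>s. 1 + 2 ^ m * (s ^ m * (p' s)\<^sup>2))"
      by (intro set_integral_add set_integrable_mult_right) auto
    show "set_borel_measurable lborel {1/2<..<1} p'"
      unfolding set_borel_measurable_def measurable_lborel2
      by (rule borel_measurable_continuous_on_indicator) (auto intro!: continuous_on_subset[OF cont])
    show "AE s in lborel. s \<in> {1/2<..<1} \<longrightarrow> norm (p' s) \<le> norm (1 + 2 ^ m * (s ^ m * (p' s)\<^sup>2))"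
    proof (intro AE_I2 impI)
      fix s :: real assume s: "s \<in> {1/2<..<1}"
      then have "1 \<le> (2 * s) ^ m" by (intro one_le_power) auto
      then have "1 * (p' s)\<^sup>2 \<le> (2 * s) ^ m * (p' s)\<^sup>2"
        by (intro mult_right_mono) auto
      moreover have "2 * \<bar>p' s\<bar> \<le> 1 + (p' s)\<^sup>2"
        using zero_le_power2[of "\<bar>p' s\<bar> - 1"] by (simp add: power2_diff)
      ultimately have "\<bar>p' s\<bar> \<le> 1 + 2 ^ m * (s ^ m * (p' s)\<^sup>2)"
        by (simp add: power_mult_distrib mult_ac)
      then show "norm (p' s) \<le> norm (1 + 2 ^ m * (s ^ m * (p' s)\<^sup>2))" by simp
    qed
  qed
  then have lim1: "(p \<longlongrightarrow> p (1/2) + (LINT s:{1/2<..<1}|lborel. p' s)) (at_left 1)" (is "(_ \<longlongrightarrow> ?l) _")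
    by (intro tendsto_at_left_FTC deriv) auto
  have "((\<lambda>s. s ^ m * (p s)\<^sup>2) \<longlongrightarrow> 1 ^ m * ?l\<^sup>2) (at_left 1)"
    by (intro tendsto_intros lim1)
  with lim2 m have "?l\<^sup>2 = (LINT s:{0<..<1}|lborel. ?q s)"
    using tendsto_unique[OF trivial_limit_at_left_real] by (fastforce simp: power_0_left)
  with lim1 show ?thesis by (rule that)
qed

lemma Cauchy_at_left_iff:
  fixes f :: "real \<Rightarrow> 'a::complete_space"
  shows "(\<exists>l. (f \<longlongrightarrow> l) (at_left a)) \<longleftrightarrow>
    (\<forall>k::nat. \<exists>m::nat. \<forall>s\<in>{a - 1 / real (Suc m)<..<a}. \<forall>t\<in>{a - 1 / real (Suc m)<..<a}.
       dist (f s) (f t) \<le> 1 / real (Suc k))" (is "?L \<longleftrightarrow> ?R")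
proof
  assume ?L
  then obtain l where l: "(f \<longlongrightarrow> l) (at_left a)" by blast
  show ?R
  proof
    fix k :: nat
    have "eventually (\<lambda>s. dist (f s) l < 1 / real (Suc k) / 2) (at_left a)"
      using l by (rule tendstoD) simp
    then obtain b where b: "b < a" "\<And>s. b < s \<Longrightarrow> s < a \<Longrightarrow> dist (f s) l < 1 / real (Suc k) / 2"
      by (auto simp: eventually_at_left_field)
    then obtain m where m: "1 / real (Suc m) < a - b"
      by (metis diff_gt_0_iff_gt inverse_eq_divide reals_Archimedean)
    have "dist (f s) (f t) \<le> 1 / real (Suc k)"
      if "s \<in> {a - 1 / real (Suc m)<..<a}" "t \<in> {a - 1 / real (Suc m)<..<a}" for s t
    proof -
      have "b < s" "b < t" using that m by auto
      with that have "dist (f s) l < 1 / real (Suc k) / 2" "dist (f t) l < 1 / real (Suc k) / 2"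
        using b(2)[of s] b(2)[of t] by (simp_all only: greaterThanLessThan_iff)
      then show ?thesis using dist_triangle_half_l less_imp_le by blast
    qed
    then show "\<exists>m::nat. \<forall>s\<in>{a - 1 / real (Suc m)<..<a}. \<forall>t\<in>{a - 1 / real (Suc m)<..<a}.
       dist (f s) (f t) \<le> 1 / real (Suc k)" by blast
  qed
next
  assume R: ?R
  have "cauchy_filter (filtermap f (at_left a))"
    unfolding cauchy_filter_metric_filtermap
  proof (intro allI impI)
    fix e :: real assume "e > 0"
    then obtain k where k: "1 / real (Suc k) < e"
      by (metis inverse_eq_divide reals_Archimedean)
    from R obtain m :: nat where m: "\<And>s t. s\<in>{a - 1 / real (Suc m)<..<a} \<Longrightarrow>
        t\<in>{a - 1 / real (Suc m)<..<a} \<Longrightarrow> dist (f s) (f t) \<le> 1 / real (Suc k)" by metis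
    have "eventually (\<lambda>s. s \<in> {a - 1 / real (Suc m)<..<a}) (at_left a)"
      by (intro eventually_at_left_real) auto
    with m k show "\<exists>P. eventually P (at_left a) \<and> (\<forall>x y. P x \<and> P y \<longrightarrow> dist (f x) (f y) < e)"
      by (intro exI[of _ "\<lambda>s. s \<in> {a - 1 / real (Suc m)<..<a}"]) (auto intro: le_less_trans)
  qed
  then have "\<exists>l. filtermap f (at_left a) \<le> nhds l"
    using cauchy_filter_complete_converges[of "filtermap f (at_left a)" UNIV] complete_UNIV
    by (auto simp: trivial_limit_at_left_real filtermap_bot_iff)
  then show ?L by (simp add: filterlim_def)
qed

lemma borel_measurable_boundary_value:
  fixes \<phi> :: "real ^ 'n::finite \<Rightarrow> real"
  assumes R: "0 < R" and cont: "continuous_on (ball 0 R) \<phi>"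
  shows "(\<lambda>x. indicator (sphere 0 R) x *\<^sub>R (boundary_value \<phi> x)\<^sup>2) \<in> borel_measurable borel"
proof -
  let ?I = "\<lambda>m. {1 - 1 / real (Suc m)<..<1::real}"
  \<comment> \<open>The radial limit exists iff \<open>\<phi> (s x)\<close> is Cauchy as \<open>s\<close> tends to \<open>1\<close>. Each failure set is a union of
    relatively open subsets of the sphere, so no countability of the parameters \<open>s, t\<close> is needed.\<close>
  define V where "V k m = (\<Union>s\<in>?I m. \<Union>t\<in>?I m. {x \<in> sphere 0 R. 1 / real (Suc k) < dist (\<phi> (s *\<^sub>R x)) (\<phi> (t *\<^sub>R x))})" for k m
  define E where "E = {x \<in> sphere 0 R. \<exists>l. ((\<lambda>t. \<phi> (t *\<^sub>R x)) \<longlongrightarrow> l) (at_left 1)}"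
  have I: "0 \<le> s" "s < 1" if "s \<in> ?I m" for s m
  proof -
    have "1 / real (Suc m) \<le> 1" by simp
    with that show "0 \<le> s" unfolding greaterThanLessThan_iff by linarith
  qed (use that in auto)
  have contI: "continuous_on (sphere 0 R) (\<lambda>x. \<phi> (s *\<^sub>R x))" if "s \<in> ?I m" for s m
    using I[OF that] R
    by (intro continuous_on_compose2[OF cont] continuous_intros) (auto simp: mult_less_cancel_right2)
  have V: "V k m \<in> sets borel" for k m
  proof -
    have *: "openin (top_of_set (sphere 0 R))
        {x \<in> sphere 0 R. 1 / real (Suc k) < dist (\<phi> (s *\<^sub>R x)) (\<phi> (t *\<^sub>R x))}"
      if "s \<in> ?I m" "t \<in> ?I m" for s t
    proof -
      have "continuous_on (sphere 0 R) (\<lambda>x. dist (\<phi> (s *\<^sub>R x)) (\<phi> (t *\<^sub>R x)))"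
        using that by (intro continuous_on_dist contI)
      then have "openin (top_of_set (sphere 0 R)) (sphere 0 R \<inter> (\<lambda>x. dist (\<phi> (s *\<^sub>R x)) (\<phi> (t *\<^sub>R x))) -` {1 / real (Suc k)<..})"
        by (rule continuous_openin_preimage_gen) (rule open_greaterThan)
      also have "sphere 0 R \<inter> (\<lambda>x. dist (\<phi> (s *\<^sub>R x)) (\<phi> (t *\<^sub>R x))) -` {1 / real (Suc k)<..} =
         {x \<in> sphere 0 R. 1 / real (Suc k) < dist (\<phi> (s *\<^sub>R x)) (\<phi> (t *\<^sub>R x))}"
        unfolding vimage_def greaterThan_iff by blast
      finally show ?thesis .
    qed
    have "openin (top_of_set (sphere 0 R)) (V k m)"
      unfolding V_def by (rule openin_Union, erule imageE, hypsubst)+ (rule *)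
    then obtain U where "open U" "V k m = sphere 0 R \<inter> U" by (auto simp: openin_open)
    then show ?thesis by auto
  qed
  have "E = (\<Inter>k. \<Union>m. sphere 0 R - V k m)"
  proof -
    define Q where "Q x k m \<longleftrightarrow> (\<forall>s\<in>?I m. \<forall>t\<in>?I m. dist (\<phi> (s *\<^sub>R x)) (\<phi> (t *\<^sub>R x)) \<le> 1 / real (Suc k))"
      for x k m
    have 1: "x \<in> sphere 0 R - V k m \<longleftrightarrow> x \<in> sphere 0 R \<and> Q x k m" for x k m
      unfolding V_def Q_def not_less[symmetric] by blast
    have 2: "x \<in> E \<longleftrightarrow> x \<in> sphere 0 R \<and> (\<forall>k. \<exists>m. Q x k m)" for x
      unfolding E_def Q_def Cauchy_at_left_iff by (rule mem_Collect_eq)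
    show ?thesis
      unfolding set_eq_iff INT_iff UN_iff 1 2 by simp
  qed
  then have E[measurable]: "E \<in> sets borel"
    using V by auto
  define \<psi> where "\<psi> x = indicator (ball 0 R) x * \<phi> x" for x
  have [measurable]: "\<psi> \<in> borel_measurable borel"
    using borel_measurable_continuous_on_indicator[OF open_ball[THEN borel_open] cont]
    by (simp add: \<psi>_def[abs_def])
  define t where "t i = 1 + - inverse (real (Suc i))" for i :: nat
  have t: "0 \<le> t i" "t i < 1" for i by (auto simp: t_def field_simps)
  have tlim: "filterlim t (at_left 1) sequentially"
  proof -
    have "t \<longlonglongrightarrow> 1"
      unfolding t_def by (rule LIMSEQ_inverse_real_of_nat_add_minus)
    then show ?thesis
      unfolding filterlim_at using t by (auto intro!: always_eventually simp: less_imp_neq)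
  qed
  have bv: "boundary_value \<phi> x = lim (\<lambda>i. \<psi> (t i *\<^sub>R x))" if x: "x \<in> E" for x
  proof -
    from x obtain l where l: "((\<lambda>t. \<phi> (t *\<^sub>R x)) \<longlongrightarrow> l) (at_left 1)" and nx: "norm x = R"
      by (auto simp: E_def)
    have "(\<lambda>i. \<phi> (t i *\<^sub>R x)) \<longlonglongrightarrow> l"
      using filterlim_compose[OF l tlim] .
    moreover have "\<psi> (t i *\<^sub>R x) = \<phi> (t i *\<^sub>R x)" for i
      using nx t[of i] R by (auto simp: \<psi>_def indicator_def mult_less_cancel_right2)
    ultimately show ?thesis
      using l by (simp add: boundary_value_def tendsto_Lim limI)
  qed
  \<comment> \<open>Where there is no radial limit, \<^const>\<open>Lim\<close> yields one fixed junk value.\<close>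
  have nb: "boundary_value \<phi> x = (THE l. False)" if "x \<in> sphere 0 R" "x \<notin> E" for x
    using that by (auto simp: E_def boundary_value_def t2_space_class.Lim_def)
  have "indicator (sphere 0 R) x *\<^sub>R (boundary_value \<phi> x)\<^sup>2 =
      indicator E x * (lim (\<lambda>i. \<psi> (t i *\<^sub>R x)))\<^sup>2 + indicator (sphere 0 R - E) x * (THE l. False)\<^sup>2" for x
    using bv[of x] nb[of x] by (auto simp: indicator_def E_def)
  moreover have "(\<lambda>x. indicator E x * (lim (\<lambda>i. \<psi> (t i *\<^sub>R x)))\<^sup>2 + indicator (sphere 0 R - E) x * (THE l. False)\<^sup>2)
      \<in> borel_measurable borel"
    using E by (intro borel_measurable_add borel_measurable_times borel_measurable_power
      borel_measurable_lim_metric borel_measurable_indicator borel_measurable_const sets.Diff) simp_all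
  ultimately show ?thesis by (simp only:)
qed

section \<open>The divergence identity\<close>

lemma Cinf_onD:
  assumes "Cinf_on S \<phi>"
  shows "continuous_on S \<phi>" "continuous_on S (gradient \<phi>)"
    and "x \<in> S \<Longrightarrow> (\<phi> has_derivative (\<lambda>h. gradient \<phi> x \<bullet> h)) (at x)"
proof -
  from assms have C: "Ck_on 0 S \<phi>" "Ck_on (Suc 0) S \<phi>" unfolding Cinf_on_def by blast+
  show "continuous_on S \<phi>" using C(1) by simp
  show "continuous_on S (gradient \<phi>)"
    unfolding gradient_def[abs_def] using C(2) by (auto intro!: continuous_on_vec_lambda)
  assume "x \<in> S"
  with C(2) have D: "(\<phi> has_derivative frechet_derivative \<phi> (at x)) (at x)"
    by (simp add: frechet_derivative_works)
  have "frechet_derivative \<phi> (at x) h = gradient \<phi> x \<bullet> h" for h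
  proof -
    interpret linear "frechet_derivative \<phi> (at x)"
      using D by (rule has_derivative_linear)
    have "frechet_derivative \<phi> (at x) h = frechet_derivative \<phi> (at x) (\<Sum>i\<in>UNIV. h $ i *\<^sub>R axis i 1)"
      using basis_expansion[of h] by (simp add: scalar_mult_eq_scaleR)
    also have "\<dots> = (\<Sum>i\<in>UNIV. h $ i * partial_deriv i \<phi> x)"
      by (simp add: sum scale partial_deriv_def)
    also have "\<dots> = gradient \<phi> x \<bullet> h"
      by (simp add: gradient_def inner_vec_def mult.commute)
    finally show ?thesis .
  qed
  then have "frechet_derivative \<phi> (at x) = (\<lambda>h. gradient \<phi> x \<bullet> h)" by blast
  with D show "(\<phi> has_derivative (\<lambda>h. gradient \<phi> x \<bullet> h)) (at x)" by simp
qed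

lemma continuous_on_open_nn_integral_zero:
  fixes f :: "'a::euclidean_space \<Rightarrow> real"
  assumes S: "open S" and f: "continuous_on S f" "\<And>x. x \<in> S \<Longrightarrow> 0 \<le> f x"
    and z: "(\<integral>\<^sup>+x\<in>S. ennreal (f x) \<partial>lborel) = 0" and x: "x \<in> S"
  shows "f x = 0"
proof (rule ccontr)
  assume "f x \<noteq> 0"
  define U where "U = {y \<in> S. 0 < f y}"
  have "U = S \<inter> f -` {0<..}" by (auto simp: U_def)
  then have U: "open U" using continuous_open_preimage[OF f(1) S, of "{0<..}"] by simp
  have m: "(\<lambda>x. ennreal (f x) * indicator S x) \<in> borel_measurable borel"
  proof -
    have "(\<lambda>x. ennreal (indicator S x *\<^sub>R f x)) \<in> borel_measurable borel"
      using S f(1) by (intro measurable_compose[OF borel_measurable_continuous_on_indicator measurable_ennreal]) auto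
    also have "(\<lambda>x. ennreal (indicator S x *\<^sub>R f x)) = (\<lambda>x. ennreal (f x) * indicator S x)"
      by (auto simp: indicator_def)
    finally show ?thesis .
  qed
  have "AE x in lborel. ennreal (f x) * indicator S x = 0"
    using z m by (subst (asm) nn_integral_0_iff_AE) auto
  then have "AE x in lborel. x \<notin> U"
    by eventually_elim (auto simp: U_def)
  then have "U \<in> null_sets lborel"
    using U AE_iff_null_sets[of U lborel] by simp
  then have "negligible U"
    using negligible_iff_null_sets null_sets_completionI by blast
  moreover have "x \<in> U" using \<open>f x \<noteq> 0\<close> f(2)[OF x] x by (auto simp: U_def)
  ultimately show False using open_not_negligible[OF U] by blast
qed

lemma set_integrable_sq_div_norm:
  fixes \<phi> :: "real ^ 'n::finite \<Rightarrow> real"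
  assumes n: "2 \<le> CARD('n)" and R: "0 < R" and cont: "continuous_on (ball 0 R) \<phi>"
    and int: "set_integrable lborel (ball 0 R) (\<lambda>x. (\<phi> x)\<^sup>2)"
  shows "set_integrable lborel (ball 0 R) (\<lambda>x. (\<phi> x)\<^sup>2 / norm x)"
proof -
  have "compact (\<phi> ` cball 0 (R / 2))"
    using R by (intro compact_continuous_image continuous_on_subset[OF cont]) auto
  then have "bounded (\<phi> ` cball 0 (R / 2))" by (rule compact_imp_bounded)
  then obtain M where "\<forall>y\<in>\<phi> ` cball 0 (R / 2). \<bar>y\<bar> \<le> M"
    unfolding bounded_iff real_norm_def by blast
  then have M: "\<bar>\<phi> x\<bar> \<le> M" if "x \<in> cball 0 (R / 2)" for x
    using that by blast
  show ?thesis
  proof (rule set_integrable_bound)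
    show "set_integrable lborel (ball 0 R) (\<lambda>x. M\<^sup>2 * (1 / norm x) + 2 / R * (\<phi> x)\<^sup>2)"
      using int set_integrable_ball_inverse_norm[OF n R]
      by (intro set_integral_add set_integrable_mult_right) auto
    have "(\<lambda>x. (indicator (ball 0 R) x *\<^sub>R \<phi> x)\<^sup>2 / norm x) \<in> borel_measurable borel"
      by (intro borel_measurable_divide borel_measurable_power
          borel_measurable_continuous_on_indicator cont) auto
    also have "(\<lambda>x. (indicator (ball 0 R) x *\<^sub>R \<phi> x)\<^sup>2 / norm x) =
        (\<lambda>x. indicator (ball 0 R) x *\<^sub>R ((\<phi> x)\<^sup>2 / norm x))"
      by (auto simp: indicator_def)
    finally show "set_borel_measurable lborel (ball 0 R) (\<lambda>x. (\<phi> x)\<^sup>2 / norm x)"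
      by (simp add: set_borel_measurable_def)
    show "AE x in lborel. x \<in> ball 0 R \<longrightarrow>
        norm ((\<phi> x)\<^sup>2 / norm x) \<le> norm (M\<^sup>2 * (1 / norm x) + 2 / R * (\<phi> x)\<^sup>2)"
    proof (intro AE_I2 impI)
      fix x :: "real^'n" assume "x \<in> ball 0 R"
      have "(\<phi> x)\<^sup>2 / norm x \<le> M\<^sup>2 * (1 / norm x) + 2 / R * (\<phi> x)\<^sup>2"
      proof (cases "norm x \<le> R / 2")
        case True
        then have "\<bar>\<phi> x\<bar>\<^sup>2 \<le> M\<^sup>2" using M by (intro power_mono) auto
        then have "(\<phi> x)\<^sup>2 / norm x \<le> M\<^sup>2 / norm x" by (intro divide_right_mono) auto
        moreover have "0 \<le> 2 / R * (\<phi> x)\<^sup>2" using R by simp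
        ultimately show ?thesis by simp
      next
        case False
        then have "1 / norm x \<le> 1 / (R / 2)" using R by (intro divide_left_mono mult_pos_pos) auto
        then have "1 / norm x \<le> 2 / R" by simp
        then have "1 / norm x * (\<phi> x)\<^sup>2 \<le> 2 / R * (\<phi> x)\<^sup>2" by (intro mult_right_mono) auto
        then show ?thesis by (simp add: add_increasing)
      qed
      then show "norm ((\<phi> x)\<^sup>2 / norm x) \<le> norm (M\<^sup>2 * (1 / norm x) + 2 / R * (\<phi> x)\<^sup>2)" by simp
    qed
  qed
qed

lemma divergence_identity_ball:
  fixes \<phi> :: "real ^ 'n::finite \<Rightarrow> real"
  assumes n: "2 \<le> CARD('n)" and R: "0 < R" and smooth: "Cinf_on (ball 0 R) \<phi>"
    and int_grad: "set_integrable lborel (ball 0 R) (\<lambda>x. (norm (gradient \<phi> x))\<^sup>2)"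
    and int_phi: "set_integrable lborel (ball 0 R) (\<lambda>x. (\<phi> x)\<^sup>2)"
  shows "(LINT x:sphere 0 R|sphere_measure R. (boundary_value \<phi> x)\<^sup>2) =
      (real CARD('n) - 1) * (LINT x:ball 0 R|lborel. (\<phi> x)\<^sup>2 / norm x)
      + 2 * (LINT x:ball 0 R|lborel. \<phi> x * (gradient \<phi> x \<bullet> x) / norm x)"
proof -
  let ?B = "ball (0::real^'n) R" and ?S = "sphere_measure R :: (real^'n) measure"
  note cont = Cinf_onD(1)[OF smooth] and contg = Cinf_onD(2)[OF smooth]
  note deriv = Cinf_onD(3)[OF smooth]
  define m where "m = CARD('n) - 1"
  have m: "0 < m" "real CARD('n) - 1 = real m" "CARD('n) - 1 = m" using n by (auto simp: m_def)
  define P where "P x = indicator ?B x *\<^sub>R \<phi> x" for x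
  define G where "G x = indicator ?B x *\<^sub>R gradient \<phi> x" for x
  have [measurable]: "P \<in> borel_measurable borel" "G \<in> borel_measurable borel"
    using borel_measurable_continuous_on_indicator[OF open_ball[THEN borel_open] cont]
      borel_measurable_continuous_on_indicator[OF open_ball[THEN borel_open] contg]
    by (simp_all add: P_def[abs_def] G_def[abs_def])
  have PG: "P x = \<phi> x" "G x = gradient \<phi> x" if "x \<in> ?B" for x
    using that by (auto simp: P_def G_def)
  define h where "h x = real m * ((P x)\<^sup>2 / norm x) + 2 * (P x * (G x \<bullet> x) / norm x)" for x
  have h[measurable]: "h \<in> borel_measurable borel" unfolding h_def by measurable
  have ball[simp]: "?B \<in> sets lborel" by simp
  have int0: "set_integrable lborel ?B (\<lambda>x. (P x)\<^sup>2 / norm x)"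
    using set_integrable_sq_div_norm[OF n R cont int_phi] PG
    by (subst set_integrable_cong) auto
  have int1: "set_integrable lborel ?B (\<lambda>x. P x * (G x \<bullet> x) / norm x)"
  proof (rule set_integrable_bound)
    show "set_integrable lborel ?B (\<lambda>x. (\<phi> x)\<^sup>2 + (norm (gradient \<phi> x))\<^sup>2)"
      by (intro set_integral_add int_grad int_phi)
    show "set_borel_measurable lborel ?B (\<lambda>x. P x * (G x \<bullet> x) / norm x)"
      unfolding set_borel_measurable_def using ball
      by (intro borel_measurable_scaleR borel_measurable_indicator) simp_all
    show "AE x in lborel. x \<in> ?B \<longrightarrow>
        norm (P x * (G x \<bullet> x) / norm x) \<le> norm ((\<phi> x)\<^sup>2 + (norm (gradient \<phi> x))\<^sup>2)"
    proof (intro AE_I2 impI)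
      fix x assume x: "x \<in> ?B"
      let ?g = "norm (gradient \<phi> x)"
      have "\<bar>gradient \<phi> x \<bullet> x\<bar> / norm x \<le> ?g"
        using Cauchy_Schwarz_ineq2[of "gradient \<phi> x" x] by (cases "x = 0") (auto simp: divide_le_eq)
      then have "\<bar>\<phi> x\<bar> * (\<bar>gradient \<phi> x \<bullet> x\<bar> / norm x) \<le> \<bar>\<phi> x\<bar> * ?g"
        by (intro mult_left_mono) auto
      also have "\<dots> \<le> (\<phi> x)\<^sup>2 + ?g\<^sup>2"
      proof -
        have "0 \<le> (\<bar>\<phi> x\<bar> - ?g)\<^sup>2 + (\<phi> x)\<^sup>2 + ?g\<^sup>2" by simp
        then show ?thesis by (simp add: power2_diff)
      qed
      finally show "norm (P x * (G x \<bullet> x) / norm x) \<le> norm ((\<phi> x)\<^sup>2 + ?g\<^sup>2)"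
        using x by (simp add: PG abs_mult)
    qed
  qed
  have inth: "set_integrable lborel ?B h"
    unfolding h_def by (intro set_integral_add set_integrable_mult_right int0 int1)
  have intg: "set_integrable lborel ?B (\<lambda>x. (norm (G x))\<^sup>2)"
    using int_grad PG by (subst set_integrable_cong) auto
  note Ph = integral_polar_coordinates[OF R h inth, unfolded m(3)]
  have "(\<lambda>x. (norm (G x))\<^sup>2) \<in> borel_measurable borel" by measurable
  note Pg = integral_polar_coordinates(1)[OF R this intg, unfolded m(3)]
  have "AE x in ?S. indicator (sphere 0 R) x *\<^sub>R (boundary_value \<phi> x)\<^sup>2 =
      (LINT s:{0<..<1}|lborel. R * s ^ m * h (s *\<^sub>R x))"
    using AE_sphere_measure_sphere[OF R] Ph(1) Pg
  proof eventually_elim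
    case (elim x)
    then have x: "norm x = R" by simp
    have sB: "s *\<^sub>R x \<in> ?B" if "0 \<le> s" "s < 1" for s
      using that x R by (simp add: mult_less_cancel_right2)
    define p where "p s = \<phi> (s *\<^sub>R x)" for s
    define p' where "p' s = gradient \<phi> (s *\<^sub>R x) \<bullet> x" for s
    have d: "(p has_real_derivative p' s) (at s)" if "0 \<le> s" "s < 1" for s
    proof -
      have "((\<lambda>s. \<phi> (s *\<^sub>R x)) has_derivative (\<lambda>h. gradient \<phi> (s *\<^sub>R x) \<bullet> (h *\<^sub>R x))) (at s)"
        by (rule has_derivative_compose[where f = "\<lambda>s. s *\<^sub>R x" and g = \<phi>, OF _ deriv[OF sB[OF that]]])
          (auto intro!: derivative_eq_intros)
      then show ?thesis
        by (simp add: has_field_derivative_def p_def[abs_def] p'_def mult_commute_abs)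
    qed
    have cp': "continuous_on {0..<1} p'"
      unfolding p'_def using sB
      by (intro continuous_intros continuous_on_compose2[OF contg]) auto
    have i1: "set_integrable lborel {0<..<1} (\<lambda>s. s ^ m * (p' s)\<^sup>2)"
    proof (rule set_integrable_bound)
      show "set_integrable lborel {0<..<1} (\<lambda>s. R * (R * s ^ m * (norm (G (s *\<^sub>R x)))\<^sup>2))"
        using elim(3) by (intro set_integrable_mult_right) auto
      show "set_borel_measurable lborel {0<..<1} (\<lambda>s. s ^ m * (p' s)\<^sup>2)"
        unfolding set_borel_measurable_def measurable_lborel2
        by (rule borel_measurable_continuous_on_indicator)
          (auto intro!: continuous_intros continuous_on_subset[OF cp'])
      show "AE s in lborel. s \<in> {0<..<1} \<longrightarrow>
          norm (s ^ m * (p' s)\<^sup>2) \<le> norm (R * (R * s ^ m * (norm (G (s *\<^sub>R x)))\<^sup>2))"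
      proof (intro AE_I2 impI)
        fix s :: real assume s: "s \<in> {0<..<1}"
        have "\<bar>p' s\<bar> \<le> norm (G (s *\<^sub>R x)) * R"
          using Cauchy_Schwarz_ineq2[of "gradient \<phi> (s *\<^sub>R x)" x] s x sB by (simp add: p'_def PG)
        then have "\<bar>p' s\<bar>\<^sup>2 \<le> (norm (G (s *\<^sub>R x)) * R)\<^sup>2" by (intro power_mono) auto
        then have "s ^ m * (p' s)\<^sup>2 \<le> s ^ m * (norm (G (s *\<^sub>R x)) * R)\<^sup>2"
          using s by (intro mult_left_mono) auto
        then show "norm (s ^ m * (p' s)\<^sup>2) \<le> norm (R * (R * s ^ m * (norm (G (s *\<^sub>R x)))\<^sup>2))"
          using s R by (simp add: abs_mult power_mult_distrib power2_eq_square[of R] mult_ac)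
      qed
    qed
    have eq: "R * s ^ m * h (s *\<^sub>R x) = real m * s ^ (m - 1) * (p s)\<^sup>2 + 2 * s ^ m * p s * p' s"
      if "s \<in> {0<..<1}" for s
    proof -
      have "s ^ m = s * s ^ (m - 1)" using m(1) by (cases m) auto
      then show ?thesis
        using that x R sB[of s] by (simp add: h_def PG p_def p'_def field_simps power2_eq_square)
    qed
    have i2: "set_integrable lborel {0<..<1}
        (\<lambda>s. real m * s ^ (m - 1) * (p s)\<^sup>2 + 2 * s ^ m * p s * p' s)"
      using elim(2) eq by (subst set_integrable_cong[OF refl refl]) (auto simp: mult_ac)
    obtain l where l: "(p \<longlongrightarrow> l) (at_left 1)" and l2:
      "l\<^sup>2 = (LINT s:{0<..<1}|lborel. real m * s ^ (m - 1) * (p s)\<^sup>2 + 2 * s ^ m * p s * p' s)"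
      using radial_trace[OF m(1) d cp' i1 i2] by blast
    have "boundary_value \<phi> x = l"
      unfolding boundary_value_def using l by (intro tendsto_Lim) (auto simp: p_def[abs_def])
    moreover have "l\<^sup>2 = (LINT s:{0<..<1}|lborel. R * s ^ m * h (s *\<^sub>R x))"
      unfolding l2 by (rule set_lebesgue_integral_cong) (use eq in auto)
    ultimately show ?case using x by simp
  qed
  then have "(LINT x:sphere 0 R|?S. (boundary_value \<phi> x)\<^sup>2) =
      (LINT x|?S. (LINT s:{0<..<1}|lborel. R * s ^ m * h (s *\<^sub>R x)))"
    unfolding set_lebesgue_integral_def[of ?S]
    using borel_measurable_boundary_value[OF R cont] Ph(2)
    by (intro integral_cong_AE) (simp_all add: measurable_cong_sets[OF sets_sphere_measure refl])
  also have "\<dots> = (LINT x:?B|lborel. h x)" by (rule Ph(3))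
  also have "\<dots> = real m * (LINT x:?B|lborel. (P x)\<^sup>2 / norm x) + 2 * (LINT x:?B|lborel. P x * (G x \<bullet> x) / norm x)"
    unfolding h_def
    by (simp only: set_integral_add(2) set_integrable_mult_right int0 int1 set_integral_mult_right)
  also have "(LINT x:?B|lborel. (P x)\<^sup>2 / norm x) = (LINT x:?B|lborel. (\<phi> x)\<^sup>2 / norm x)"
    using PG by (intro set_lebesgue_integral_cong) auto
  also have "(LINT x:?B|lborel. P x * (G x \<bullet> x) / norm x) = (LINT x:?B|lborel. \<phi> x * (gradient \<phi> x \<bullet> x) / norm x)"
    using PG by (intro set_lebesgue_integral_cong) auto
  finally show ?thesis using m(2) by simp
qed

lemma norm_integral_le_nn_integral:
  fixes f :: "'a \<Rightarrow> 'b::{banach, second_countable_topology}"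
  shows "ennreal (norm (integral\<^sup>L M f)) \<le> (\<integral>\<^sup>+x. ennreal (norm (f x)) \<partial>M)"
  by (cases "integrable M f") (simp_all add: integral_norm_bound_ennreal not_integrable_integral_eq)

theorem corollary2p18:
  fixes \<phi> :: "real ^ 'n::finite \<Rightarrow> real" and R :: real
  assumes "CARD('n) \<ge> 2" and "R > 0" and "Cinf_on (ball 0 R) \<phi>"
  shows "(\<integral>\<^sup>+x\<in>ball 0 R. ennreal ((norm (gradient \<phi> x))\<^sup>2) \<partial>lborel)
           * (\<integral>\<^sup>+x\<in>ball 0 R. ennreal ((\<phi> x)\<^sup>2) \<partial>lborel)
         \<ge> ennreal (1 / 4 *
             ((real CARD('n) - 1) * (LINT x:ball 0 R|lborel. (\<phi> x)\<^sup>2 / norm x)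
              - (LINT x:sphere 0 R|sphere_measure R. (boundary_value \<phi> x)\<^sup>2))\<^sup>2)"
proof -
  let ?B = "ball (0::real^'n) R"
  let ?I = "\<integral>\<^sup>+x\<in>?B. ennreal ((norm (gradient \<phi> x))\<^sup>2) \<partial>lborel"
  let ?J = "\<integral>\<^sup>+x\<in>?B. ennreal ((\<phi> x)\<^sup>2) \<partial>lborel"
  note R = \<open>R > 0\<close>
  note cont = Cinf_onD(1)[OF assms(3)] and contg = Cinf_onD(2)[OF assms(3)]
  note deriv = Cinf_onD(3)[OF assms(3)]
  have P: "(\<lambda>x. indicator ?B x *\<^sub>R \<phi> x) \<in> borel_measurable borel"
    and G: "(\<lambda>x. indicator ?B x *\<^sub>R gradient \<phi> x) \<in> borel_measurable borel"
    by (rule borel_measurable_continuous_on_indicator[OF _ cont]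
        borel_measurable_continuous_on_indicator[OF _ contg], simp)+
  have set_int: "set_integrable lborel ?B f"
    if "(\<integral>\<^sup>+x\<in>?B. ennreal (f x) \<partial>lborel) < \<infinity>" "continuous_on ?B f" "\<And>x. 0 \<le> f x" for f
  proof -
    have "(\<integral>\<^sup>+x. ennreal (norm (indicator ?B x *\<^sub>R f x)) \<partial>lborel) = (\<integral>\<^sup>+x\<in>?B. ennreal (f x) \<partial>lborel)"
      using that(3) by (intro nn_integral_cong) (auto simp: indicator_def)
    then show ?thesis
      unfolding set_integrable_def using that(1)
        borel_measurable_continuous_on_indicator[OF open_ball[THEN borel_open] that(2)]
      by (intro integrableI_bounded) auto
  qed
  have c2: "continuous_on ?B (\<lambda>x. (norm (gradient \<phi> x))\<^sup>2)" "continuous_on ?B (\<lambda>x. (\<phi> x)\<^sup>2)"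
    using cont contg by (auto intro!: continuous_intros)
  consider "?I < \<infinity>" "?J < \<infinity>" | "?I = \<infinity>" | "?I < \<infinity>" "?J = \<infinity>"
    unfolding infinity_ennreal_def less_top[symmetric] by blast
  then show ?thesis
  proof cases
    case 1
    let ?K = "LINT x:?B|lborel. \<phi> x * (gradient \<phi> x \<bullet> x) / norm x"
    have "(real CARD('n) - 1) * (LINT x:?B|lborel. (\<phi> x)\<^sup>2 / norm x)
        - (LINT x:sphere 0 R|sphere_measure R. (boundary_value \<phi> x)\<^sup>2) = - 2 * ?K"
      using divergence_identity_ball[OF assms set_int[OF 1(1) c2(1)] set_int[OF 1(2) c2(2)]] by simp
    then have "ennreal (1 / 4 * ((real CARD('n) - 1) * (LINT x:?B|lborel. (\<phi> x)\<^sup>2 / norm x)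
        - (LINT x:sphere 0 R|sphere_measure R. (boundary_value \<phi> x)\<^sup>2))\<^sup>2) = (ennreal \<bar>?K\<bar>)\<^sup>2"
      by (simp add: power_mult_distrib ennreal_power)
    also have "\<dots> \<le>
        (\<integral>\<^sup>+x. ennreal (norm (indicator ?B x *\<^sub>R gradient \<phi> x)) * ennreal (norm (indicator ?B x *\<^sub>R \<phi> x)) \<partial>lborel)\<^sup>2"
    proof (rule power_mono)
      have "ennreal \<bar>?K\<bar> \<le> (\<integral>\<^sup>+x. ennreal (norm (indicator ?B x *\<^sub>R (\<phi> x * (gradient \<phi> x \<bullet> x) / norm x))) \<partial>lborel)"
        unfolding set_lebesgue_integral_def real_norm_def[symmetric]
        by (rule norm_integral_le_nn_integral)
      also have "\<dots> \<le> (\<integral>\<^sup>+x. ennreal (norm (indicator ?B x *\<^sub>R gradient \<phi> x)) * ennreal (norm (indicator ?B x *\<^sub>R \<phi> x)) \<partial>lborel)"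
      proof (rule nn_integral_mono)
        fix x
        have "\<bar>gradient \<phi> x \<bullet> x\<bar> / norm x \<le> norm (gradient \<phi> x)"
          using Cauchy_Schwarz_ineq2[of "gradient \<phi> x" x] by (cases "x = 0") (auto simp: divide_le_eq)
        then have "\<bar>\<phi> x\<bar> * (\<bar>gradient \<phi> x \<bullet> x\<bar> / norm x) \<le> \<bar>\<phi> x\<bar> * norm (gradient \<phi> x)"
          by (intro mult_left_mono) auto
        then show "ennreal (norm (indicator ?B x *\<^sub>R (\<phi> x * (gradient \<phi> x \<bullet> x) / norm x)))
            \<le> ennreal (norm (indicator ?B x *\<^sub>R gradient \<phi> x)) * ennreal (norm (indicator ?B x *\<^sub>R \<phi> x))"
          by (auto simp: indicator_def abs_mult mult.commute simp flip: ennreal_mult intro!: ennreal_leI)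
      qed
      finally show "ennreal \<bar>?K\<bar> \<le> \<dots>" .
    qed simp
    also have "\<dots> \<le> (\<integral>\<^sup>+x. (ennreal (norm (indicator ?B x *\<^sub>R gradient \<phi> x)))\<^sup>2 \<partial>lborel)
        * (\<integral>\<^sup>+x. (ennreal (norm (indicator ?B x *\<^sub>R \<phi> x)))\<^sup>2 \<partial>lborel)"
      by (rule Cauchy_Schwarz_nn_integral)
        (simp_all only: measurable_lborel2 measurable_compose[OF measurable_compose[OF P borel_measurable_norm] measurable_ennreal]
          measurable_compose[OF measurable_compose[OF G borel_measurable_norm] measurable_ennreal])
    also have "(\<integral>\<^sup>+x. (ennreal (norm (indicator ?B x *\<^sub>R gradient \<phi> x)))\<^sup>2 \<partial>lborel) = ?I"
      by (intro nn_integral_cong) (auto simp: indicator_def ennreal_power)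
    also have "(\<integral>\<^sup>+x. (ennreal (norm (indicator ?B x *\<^sub>R \<phi> x)))\<^sup>2 \<partial>lborel) = ?J"
      by (intro nn_integral_cong) (auto simp: indicator_def ennreal_power)
    finally show ?thesis .
  next
    case 2
    have "?J \<noteq> 0"
    proof
      assume "?J = 0"
      then have z: "\<phi> x = 0" if "x \<in> ?B" for x
        using continuous_on_open_nn_integral_zero[OF open_ball c2(2) _ _ that] by simp
      have "gradient \<phi> x = 0" if x: "x \<in> ?B" for x
      proof -
        have "(\<phi> has_derivative (\<lambda>h. 0)) (at x)"
          by (rule has_derivative_transform_within_open[OF has_derivative_const open_ball x, of 0]) (simp add: z)
        then have "(\<lambda>h. gradient \<phi> x \<bullet> h) = (\<lambda>h. 0)"
          using has_derivative_unique deriv[OF x] by blast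
        then have "gradient \<phi> x \<bullet> gradient \<phi> x = 0" by (rule fun_cong)
        then show ?thesis by simp
      qed
      then have "?I = (\<integral>\<^sup>+x. 0 \<partial>(lborel :: (real^'n) measure))"
        by (intro nn_integral_cong) (auto simp: indicator_def)
      with 2 show False by simp
    qed
    with 2 show ?thesis by (simp add: ennreal_top_mult)
  next
    case 3
    have "?I \<noteq> 0"
    proof
      assume "?I = 0"
      then have z: "gradient \<phi> x = 0" if "x \<in> ?B" for x
        using continuous_on_open_nn_integral_zero[OF open_ball c2(1) _ _ that] by simp
      have "\<exists>c. \<forall>x\<in>?B. \<phi> x = c"
      proof (rule has_derivative_zero_constant)
        show "(\<phi> has_derivative (\<lambda>h. 0)) (at x within ?B)" if "x \<in> ?B" for x
          using has_derivative_at_withinI[OF deriv[OF that]] z[OF that] by simp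
      qed simp
      then obtain c where c: "\<phi> x = c" if "x \<in> ?B" for x by blast
      then have "?J = (\<integral>\<^sup>+x. ennreal (c\<^sup>2) * indicator ?B x \<partial>lborel)"
        by (intro nn_integral_cong) (auto simp: indicator_def)
      also have "\<dots> = ennreal (c\<^sup>2) * emeasure lborel ?B"
        by (rule nn_integral_cmult_indicator) simp
      also have "\<dots> < \<infinity>"
        using emeasure_lborel_ball_finite[of "0::real^'n" R] by (simp add: ennreal_mult_less_top)
      finally show False using 3 by simp
    qed
    with 3 show ?thesis by (simp add: ennreal_mult_top)
  qed
qed

end
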